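(* Let $\mathcal{F}$ be a family of configurations, let $\mathcal{P}$ be a boolean predicate over $\mathcal{F}$, and let $\Sigma$ be a PLS for $(\mathcal{F},\mathcal{P})$ in the broadcast clique model with verification complexity $\kappa$. Suppose that there is a configuration $G_s\in\mathcal{F}$ such that $\mathcal{P}(G_s)=\mathrm{True}$ and the input graph $G$ contains $q$ pairwise independent oriented edges $e_1,\dots,e_q$. If $\kappa<\frac{\log q}{2}$, then there are $1\le i<j\le q$ such that $G_s(e_i,e_j)$ is accepted by $\Sigma$ (i.e., accepted by the verifier under some label assignment).
   Context: Congested clique: the communication network is the complete graph on $n$ nodes; each node has $n-1$ ports, one per other node. An input graph $G=(V,E)$ with $|V|=n$ is mapped one-to-one to the nodes. A configuration $G_s$ consists of $G$, the assignment of ports, and a state for each node; the state contains the local input, in particular for each port whether the communication edge on that port is in $E$ (and any other per-port data such as weights). States refer to incident edges via port numbers. A PLS for $(\mathcal{F},\mathcal{P})$ in the broadcast clique model is a pair (prover, verifier). Given a configuration in $\mathcal{F}$ on which $\mathcal{P}$ is true (legal), the prover assigns each node a label (bit string). Each node, as a function of its state and label, sends one and the same message on all its ports, then, as a function of its state, its label and the messages received on each port, outputs True or False. A configuration with labels is accepted if all nodes output True, and otherwise rejected. Requirements: legal configurations with the prover's labels are accepted; illegal configurations in $\mathcal{F}$ are rejected for every label assignment. Verification complexity $\kappa$ means that under the prover's labels in legal configurations the messages are $\kappa$-bit strings. $\log$ is base 2. An oriented edge is an edge with a specified order of its endpoints. Two oriented edges $e_1=(v_1,u_1)$, $e_2=(v_2,u_2)$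 of $G$ are independent if $v_1,u_1,v_2,u_2$ are four distinct nodes and $(v_1,u_2),(v_2,u_1)\notin E$. Crossing: for independent oriented edges $e_1=(v_1,u_1)$, $e_2=(v_2,u_2)$ of $G$, where $e_i$ has port number $p_i$ at $v_i$ and $q_i$ at $u_i$, the crossing $G(e_1,e_2)$ is obtained from $G$ by replacing $e_1,e_2$ with $e_1'=(v_1,u_2)$ and $e_2'=(v_2,u_1)$, where $e_1'$ connects port $p_1$ at $v_1$ with port $q_2$ at $u_2$ and $e_2'$ connects port $p_2$ at $v_2$ with port $q_1$ at $u_1$. In the clique, the non-input communication edges $(v_1,u_2)$ and $(v_2,u_1)$ are correspondingly replaced by communication edges $(v_1,u_1)$ and $(v_2,u_2)$: the port of $v_1$ that led to $u_2$ now leads to $u_1$, and similarly for $u_1$ (from $v_2$ to $v_1$), $v_2$ (from $u_1$ to $u_2$) and $u_2$ (from $v_1$ to $v_2$). All other ports and all node states are unchanged; the resulting configuration is $G_s(e_1,e_2)$. *)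

theory Defs
  imports Complex_Main
begin

text \<open>
  The input graph lives on the nodes themselves. Ports and port-indexed lists are numbered from 0,
  so the ports of a network with \<open>n\<close> nodes are \<open>0, \<dots>, n - 2\<close>.
\<close>

type_synonym bits = "bool list"

text \<open>
  \<open>port_input s ! p\<close> says whether the communication edge on port \<open>p\<close> is an input edge. Everything
  else in a state (identifier, per-port weights or marks, ...) is kept in \<open>local_data\<close>, whose type
  is arbitrary.
\<close>

record 'x node_state =
  port_input :: "bool list"
  local_data :: 'x

text \<open>\<open>port C v p\<close> is the node at the other end of port \<open>p\<close> of \<open>v\<close>.\<close>

record ('v, 'x) config =
  nodes :: "'v set"
  edges :: "'v set set"
  port :: "'v \<Rightarrow> nat \<Rightarrow> 'v"
  state :: "'v \<Rightarrow> 'x node_state"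

definition num_ports :: "('v, 'x) config \<Rightarrow> nat" where
  "num_ports C = card (nodes C) - 1"

definition valid_config :: "('v, 'x) config \<Rightarrow> bool" where
  "valid_config C \<longleftrightarrow>
     finite (nodes C) \<and>
     (\<forall>E \<in> edges C. E \<subseteq> nodes C \<and> card E = 2) \<and>
     (\<forall>v \<in> nodes C. bij_betw (port C v) {..<num_ports C} (nodes C - {v})) \<and>
     (\<forall>v \<in> nodes C. length (port_input (state C v)) = num_ports C \<and>
        (\<forall>p < num_ports C. port_input (state C v) ! p \<longleftrightarrow> {v, port C v p} \<in> edges C))"

definition port_number :: "('v, 'x) config \<Rightarrow> 'v \<Rightarrow> 'v \<Rightarrow> nat" where
  "port_number C v u = (THE p. p < num_ports C \<and> port C v p = u)"


type_synonym ('v, 'x) prover = "('v, 'x) config \<Rightarrow> 'v \<Rightarrow> bits"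

text \<open>The last argument of \<open>decide\<close> lists the received messages by port number.\<close>

record 'x verifier =
  message :: "'x node_state \<Rightarrow> bits \<Rightarrow> bits"
  decide :: "'x node_state \<Rightarrow> bits \<Rightarrow> bits list \<Rightarrow> bool"

definition sent :: "'x verifier \<Rightarrow> ('v, 'x) config \<Rightarrow> ('v \<Rightarrow> bits) \<Rightarrow> 'v \<Rightarrow> bits" where
  "sent ver C L v = message ver (state C v) (L v)"

definition received :: "'x verifier \<Rightarrow> ('v, 'x) config \<Rightarrow> ('v \<Rightarrow> bits) \<Rightarrow> 'v \<Rightarrow> bits list" where
  "received ver C L v = map (\<lambda>p. sent ver C L (port C v p)) [0..<num_ports C]"

definition accepts :: "'x verifier \<Rightarrow> ('v, 'x) config \<Rightarrow> ('v \<Rightarrow> bits) \<Rightarrow> bool" where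
  "accepts ver C L \<longleftrightarrow> (\<forall>v \<in> nodes C. decide ver (state C v) (L v) (received ver C L v))"

definition is_pls ::
  "('v, 'x) config set \<Rightarrow> (('v, 'x) config \<Rightarrow> bool) \<Rightarrow> ('v, 'x) prover \<times> 'x verifier \<Rightarrow> bool" where
  "is_pls \<F> \<P> = (\<lambda>(prov, ver).
     (\<forall>C \<in> \<F>. \<P> C \<longrightarrow> accepts ver C (prov C)) \<and>
     (\<forall>C \<in> \<F>. \<not> \<P> C \<longrightarrow> (\<forall>L. \<not> accepts ver C L)))"

definition has_verification_complexity ::
  "('v, 'x) config set \<Rightarrow> (('v, 'x) config \<Rightarrow> bool) \<Rightarrow> ('v, 'x) prover \<times> 'x verifier \<Rightarrow> nat \<Rightarrow> bool" where
  "has_verification_complexity \<F> \<P> = (\<lambda>(prov, ver) \<kappa>.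
     \<forall>C \<in> \<F>. \<P> C \<longrightarrow> (\<forall>v \<in> nodes C. length (sent ver C (prov C) v) = \<kappa>))"

definition accepted_by :: "('v, 'x) prover \<times> 'x verifier \<Rightarrow> ('v, 'x) config \<Rightarrow> bool" where
  "accepted_by S C \<longleftrightarrow> (\<exists>L. accepts (snd S) C L)"


definition oriented_edge :: "('v, 'x) config \<Rightarrow> 'v \<times> 'v \<Rightarrow> bool" where
  "oriented_edge C = (\<lambda>(v, u). {v, u} \<in> edges C)"

definition independent_edges :: "('v, 'x) config \<Rightarrow> 'v \<times> 'v \<Rightarrow> 'v \<times> 'v \<Rightarrow> bool" where
  "independent_edges C = (\<lambda>(v1, u1) (v2, u2).
     distinct [v1, u1, v2, u2] \<and> {v1, u2} \<notin> edges C \<and> {v2, u1} \<notin> edges C)"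

text \<open>
  At each of the four endpoints two ports exchange their targets: the one of the removed input edge,
  which now carries a new input edge, and the one of the non-input communication edge that this new
  input edge replaces.
\<close>

definition crossing :: "('v, 'x) config \<Rightarrow> 'v \<times> 'v \<Rightarrow> 'v \<times> 'v \<Rightarrow> ('v, 'x) config" where
  "crossing C = (\<lambda>(v1, u1) (v2, u2). C\<lparr>
     edges := (edges C - {{v1, u1}, {v2, u2}}) \<union> {{v1, u2}, {v2, u1}},
     port := (port C)(
       v1 := (port C v1)(port_number C v1 u1 := u2, port_number C v1 u2 := u1),
       u1 := (port C u1)(port_number C u1 v1 := v2, port_number C u1 v2 := v1),
       v2 := (port C v2)(port_number C v2 u2 := u1, port_number C v2 u1 := u2),
       u2 := (port C u2)(port_number C u2 v2 := v1, port_number C u2 v1 := v2))\<rparr>)"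

end

theory Submission
  imports Defs
begin

text \<open>
  A crossing only exchanges, at each of its four endpoints, the two neighbours \<open>u\<^sub>1, u\<^sub>2\<close> (resp.
  \<open>v\<^sub>1, v\<^sub>2\<close>). If \<open>v\<^sub>1, v\<^sub>2\<close> broadcast the same message, and so do \<open>u\<^sub>1, u\<^sub>2\<close>, then no node can tell
  the crossed configuration from the original one under the original labels. There are only
  \<open>2\<^sup>2\<^sup>\<kappa> < q\<close> pairs of \<open>\<kappa>\<close>-bit messages, so two of the \<open>q\<close> edges have the same pair.
\<close>

text \<open>Bijectivity of \<open>port C v\<close> onto the other nodes makes the \<open>THE\<close>
  in \<open>port_number\<close> well defined.\<close>

lemma port_port_number:
  assumes "valid_config C" "v \<in> nodes C" "u \<in> nodes C" "u \<noteq> v"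
  shows "port C v (port_number C v u) = u"
proof -
  have bij: "bij_betw (port C v) {..<num_ports C} (nodes C - {v})"
    using assms(1,2) unfolding valid_config_def by blast
  moreover have "u \<in> port C v ` {..<num_ports C}"
    using bij_betw_imp_surj_on[OF bij] assms(3,4) by blast
  ultimately have "\<exists>!p. p \<in> {..<num_ports C} \<and> port C v p = u"
    unfolding bij_betw_def inj_on_def by blast
  from theI'[OF this] show ?thesis
    by (simp add: port_number_def)
qed

lemma crossing_simps [simp]:
  "nodes (crossing C e1 e2) = nodes C"
  "state (crossing C e1 e2) = state C"
  "num_ports (crossing C e1 e2) = num_ports C"
  "sent ver (crossing C e1 e2) = sent ver C"
  by (simp_all add: crossing_def num_ports_def sent_def fun_eq_iff split: prod.splits)

text \<open>Before the update the two ports lead to \<open>x\<close> and \<open>y\<close>, so it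
  only exchanges two equal messages. Each endpoint of a crossing is an instance.\<close>

lemma sent_swapped_ports:
  assumes "valid_config C" "{w, x, y} \<subseteq> nodes C" "x \<noteq> w" "y \<noteq> w"
    and "sent ver C L x = sent ver C L y"
  shows "sent ver C L (((port C w)(port_number C w x := y, port_number C w y := x)) p) =
    sent ver C L (port C w p)"
  using assms by (simp add: port_port_number)

lemma sent_port_crossing:
  assumes "valid_config C" "distinct [v1, u1, v2, u2]" "{v1, u1, v2, u2} \<subseteq> nodes C"
    and "sent ver C L v1 = sent ver C L v2" "sent ver C L u1 = sent ver C L u2"
  shows "sent ver C L (port (crossing C (v1, u1) (v2, u2)) w p) = sent ver C L (port C w p)"
proof -
  have swap:
    "sent ver C L (((port C v1)(port_number C v1 u1 := u2, port_number C v1 u2 := u1)) p) =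
      sent ver C L (port C v1 p)"
    "sent ver C L (((port C u1)(port_number C u1 v1 := v2, port_number C u1 v2 := v1)) p) =
      sent ver C L (port C u1 p)"
    "sent ver C L (((port C v2)(port_number C v2 u2 := u1, port_number C v2 u1 := u2)) p) =
      sent ver C L (port C v2 p)"
    "sent ver C L (((port C u2)(port_number C u2 v2 := v1, port_number C u2 v1 := v2)) p) =
      sent ver C L (port C u2 p)"
    by (rule sent_swapped_ports; use assms in auto)+
  \<comment> \<open>The cases peel off the updates in \<open>crossing\<close> from the outermost, at
    \<open>u2\<close>, inwards. Without \<open>fun_upd_apply\<close> the port updates stay folded
    and match \<open>swap\<close>.\<close>
  consider "w = u2" | "w \<noteq> u2" "w = v2" | "w \<noteq> u2" "w \<noteq> v2" "w = u1"
    | "w \<noteq> u2" "w \<noteq> v2" "w \<noteq> u1" "w = v1" | "w \<notin> {v1, u1, v2, u2}"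
    by auto
  then show ?thesis
    using swap assms(2)
    by cases (simp_all add: crossing_def fun_upd_same fun_upd_other del: fun_upd_apply)
qed

text \<open>A node decides from its state, its label and the messages listed by port; the crossing
  preserves all three.\<close>

lemma accepts_crossing_iff:
  assumes "valid_config C" "distinct [v1, u1, v2, u2]" "{v1, u1, v2, u2} \<subseteq> nodes C"
    and "sent ver C L v1 = sent ver C L v2" "sent ver C L u1 = sent ver C L u2"
  shows "accepts ver (crossing C (v1, u1) (v2, u2)) L \<longleftrightarrow> accepts ver C L"
  using sent_port_crossing[OF assms] by (simp add: accepts_def received_def)

lemma pair_of_bitstrings_pigeonhole:
  fixes f g :: "'i :: linorder \<Rightarrow> bool list"
  assumes "\<And>i. i \<in> A \<Longrightarrow> length (f i) = k" "\<And>i. i \<in> A \<Longrightarrow> length (g i) = k"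
    and "2 ^ (2 * k) < card A"
  obtains i j where "i \<in> A" "j \<in> A" "i < j" "f i = f j" "g i = g j"
proof -
  let ?B = "{xs :: bool list. length xs = k}"
  have B: "finite ?B" "card ?B = 2 ^ k"
    using finite_lists_length_eq[of "UNIV :: bool set" k]
      card_lists_length_eq[of "UNIV :: bool set" k] by simp_all
  have "(\<lambda>i. (f i, g i)) ` A \<subseteq> ?B \<times> ?B"
    using assms by auto
  then have "card ((\<lambda>i. (f i, g i)) ` A) \<le> card (?B \<times> ?B)"
    using B by (intro card_mono) auto
  also have "\<dots> < card A"
    using assms(3) B by (simp add: card_cartesian_product mult_2 power_add)
  finally have "\<not> inj_on (\<lambda>i. (f i, g i)) A"
    by (rule pigeonhole)
  then obtain i j where "i \<in> A" "j \<in> A" "i \<noteq> j" "f i = f j" "g i = g j"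
    by (auto simp: inj_on_def)
  then show thesis
    using that by (metis linorder_neqE)
qed

lemma power_less_of_less_log_half:
  assumes "real k < log 2 (real q) / 2"
  shows "2 ^ (2 * k) < q"
proof -
  \<comment> \<open>By convention \<open>log 2 0 = 0\<close>, so \<open>q = 0\<close> would force
    \<open>real k < 0\<close>.\<close>
  have "q > 0"
    using assms by (cases "q = 0") (auto simp: log_def)
  moreover have "real (2 * k) < log 2 (real q)"
    using assms by simp
  ultimately have "2 powr real (2 * k) < real q"
    by (subst (asm) less_log_iff) auto
  then have "real (2 ^ (2 * k)) < real q"
    by (simp only: powr_realpow of_nat_power of_nat_numeral zero_less_numeral)
  then show ?thesis
    by (simp only: of_nat_less_iff)
qed

theorem lemma12:
  fixes \<F> :: "('v, 'x) config set"
    and \<P> :: "('v, 'x) config \<Rightarrow> bool"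
    and \<Sigma> :: "('v, 'x) prover \<times> 'x verifier"
    and G\<^sub>s :: "('v, 'x) config"
    and e :: "nat \<Rightarrow> 'v \<times> 'v"
    and q \<kappa> :: nat
  assumes "\<forall>C \<in> \<F>. valid_config C"
    and "is_pls \<F> \<P> \<Sigma>"
    and "has_verification_complexity \<F> \<P> \<Sigma> \<kappa>"
    and "G\<^sub>s \<in> \<F>" and "\<P> G\<^sub>s"
    and "\<forall>i \<in> {1..q}. oriented_edge G\<^sub>s (e i)"
    and "\<forall>i \<in> {1..q}. \<forall>j \<in> {1..q}. i \<noteq> j \<longrightarrow> independent_edges G\<^sub>s (e i) (e j)"
    and "real \<kappa> < log 2 (real q) / 2"
  shows "\<exists>i j. 1 \<le> i \<and> i < j \<and> j \<le> q \<and> accepted_by \<Sigma> (crossing G\<^sub>s (e i) (e j))"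
proof -
  obtain prov ver where \<Sigma>: "\<Sigma> = (prov, ver)"
    by fastforce
  let ?L = "prov G\<^sub>s"
  have valid: "valid_config G\<^sub>s"
    using assms by blast
  have accepted: "accepts ver G\<^sub>s ?L"
    using assms \<Sigma> by (simp add: is_pls_def)
  have len: "length (sent ver G\<^sub>s ?L v) = \<kappa>" if "v \<in> nodes G\<^sub>s" for v
    using assms that \<Sigma> by (simp add: has_verification_complexity_def)
  have e_nodes: "fst (e i) \<in> nodes G\<^sub>s" "snd (e i) \<in> nodes G\<^sub>s" if "i \<in> {1..q}" for i
  proof -
    have "{fst (e i), snd (e i)} \<in> edges G\<^sub>s"
      using assms(6) that by (simp add: oriented_edge_def split_beta)
    then have "{fst (e i), snd (e i)} \<subseteq> nodes G\<^sub>s"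
      using valid unfolding valid_config_def by blast
    then show "fst (e i) \<in> nodes G\<^sub>s" "snd (e i) \<in> nodes G\<^sub>s"
      by auto
  qed
  have "2 ^ (2 * \<kappa>) < card {1..q}"
    using power_less_of_less_log_half[OF assms(8)] by simp
  \<comment> \<open>Each edge is coloured by the messages of its tail and its head, in this order: a
    crossing exchanges tails with tails and heads with heads. \<open>rotated 2\<close> puts the
    cardinality bound first, to be met by the chained fact.\<close>
  then obtain i j where ij: "i \<in> {1..q}" "j \<in> {1..q}" "i < j"
    and same: "sent ver G\<^sub>s ?L (fst (e i)) = sent ver G\<^sub>s ?L (fst (e j))"
      "sent ver G\<^sub>s ?L (snd (e i)) = sent ver G\<^sub>s ?L (snd (e j))"
    by (rule pair_of_bitstrings_pigeonhole[of "{1..q}" "\<lambda>i. sent ver G\<^sub>s ?L (fst (e i))" \<kappa>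
          "\<lambda>i. sent ver G\<^sub>s ?L (snd (e i))", rotated 2]) (blast intro: len e_nodes)+
  have "independent_edges G\<^sub>s (e i) (e j)"
    using assms(7) ij by auto
  then have "distinct [fst (e i), snd (e i), fst (e j), snd (e j)]"
    by (simp add: independent_edges_def split_beta)
  \<comment> \<open>The witness is the prover's labelling of the uncrossed configuration; what the
    prover assigns to the crossed one is irrelevant to \<open>accepted_by\<close>.\<close>
  then have "accepts ver (crossing G\<^sub>s (e i) (e j)) ?L"
    using accepts_crossing_iff[OF valid _ _ same] accepted e_nodes ij by simp
  then show ?thesis
    using ij \<Sigma> by (auto simp: accepted_by_def)
qed

end
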